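(* Let $d\ge5$, let $0<\gamma<d-2$, put $p_N=N^{-\gamma}$, let $0<\delta<1$, and let $\Omega_N\subseteq Q_N$ be the binomial random subset obtained by retaining each point of $Q_N$ independently with probability $p_N$. There exists a constant $\mathfrak c=\mathfrak c(d,\delta,\gamma)>0$ such that for every fixed finite set $F\subseteq\mathbb Z$ with $|F|\ge2$ and all sufficiently large $N$, with probability at least $1-\exp(-\mathfrak cN^{d-\gamma})$, every subset $B\subseteq\Omega_N$ satisfying $|B|\ge\delta|\Omega_N|$ has the property that there exist $a\in\mathbb Z$ and $t\in\mathbb N$ (so $t\ge1$) such that $$a+tF\subseteq D^2(B).$$
   Context: $Q_N=[-N,N]^d\cap\mathbb Z^d$. $D^2(B)=\{|\mathbf x-\mathbf y|^2:\mathbf x,\mathbf y\in B\}$ is the squared-distance set of $B$ (Euclidean norm). $a+tF=\{a+tf:f\in F\}$. *)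

theory Defs
  imports "HOL-Analysis.Analysis" "HOL-Probability.Probability" "HOL-Probability.Product_PMF"
begin

definition lattice_box :: "nat \<Rightarrow> (int ^ 'd) set" where
  "lattice_box N = {x. \<forall>i. \<bar>x $ i\<bar> \<le> int N}"

text \<open>
  The type \<open>int ^ 'd\<close> carries no Euclidean norm, so the squared Euclidean distance is
  given by its coordinate formula; \<open>sq_dist_eq_dist\<close> relates it to the distance on
  \<open>real ^ 'd\<close>.
\<close>

definition sq_dist :: "int ^ 'd \<Rightarrow> int ^ 'd \<Rightarrow> int" where
  "sq_dist x y = (\<Sum>i\<in>UNIV. (x $ i - y $ i)\<^sup>2)"

lemma sq_dist_eq_dist:
  fixes x y :: "int ^ 'd"
  shows "real_of_int (sq_dist x y) =
    (dist (\<chi> i. real_of_int (x $ i)) (\<chi> i. real_of_int (y $ i)))\<^sup>2"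
  by (simp add: sq_dist_def dist_vec_def L2_set_def dist_real_def sum_nonneg)

definition sq_dist_set :: "(int ^ 'd) set \<Rightarrow> int set" where
  "sq_dist_set B = {sq_dist x y | x y. x \<in> B \<and> y \<in> B}"

text \<open>
  The law of the random subset of a finite set \<open>A\<close> that retains each point independently
  with probability \<open>p\<close>; intended for \<open>0 \<le> p \<le> 1\<close>.
\<close>

definition binomial_subset :: "'a set \<Rightarrow> real \<Rightarrow> 'a set pmf" where
  "binomial_subset A p =
     map_pmf (\<lambda>f. {x \<in> A. f x}) (Pi_pmf A False (\<lambda>_. bernoulli_pmf p))"

end

theory Submission
  imports Defs
begin

text \<open>
  Suppose a set \<open>B \<subseteq> \<Omega>\<close> violates the conclusion and put \<open>D = sq_dist_set B\<close>, so that \<open>D\<close>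
  contains no image \<open>a + t F\<close>. Then \<open>B\<close> is a clique of the relation \<open>sq_dist x y \<in> D\<close> on the
  box \<open>Q\<close>. There are only \<open>2 ^ O(N\<^sup>2)\<close> candidates for \<open>D\<close>, and since \<open>d - \<gamma> > 2\<close> a union
  bound over all of them costs nothing against \<open>exp (- c N powr (d - \<gamma>))\<close>. For one fixed \<open>D\<close>
  the cliques are handled by containers: if every \<open>A \<subseteq> Q\<close> of density \<open>\<delta> / 2\<close> contains at
  least \<open>\<beta> |Q|\<^sup>2\<close> pairs whose squared distance avoids \<open>D\<close>, then polynomially many sets of
  density at most \<open>\<delta> / 2\<close> cover all cliques (\<open>clique_containers\<close>), and a Chernoff bound shows
  that \<open>\<Omega>\<close> is unlikely to have a proportion \<open>\<delta>\<close> of its points in one of them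
  (\<open>binomial_subset_relative_upper_tail\<close>). The exponent there depends on \<open>\<delta>\<close> only, which makes
  the final constant independent of \<open>F\<close>.

  What remains is the supersaturation statement \<open>affine_avoiding_supersaturation\<close>. Multiplying
  four of the coordinates, read as a quaternion, by quaternions \<open>c f\<close> whose norms depend affinely
  on \<open>f\<close> gives injective linear maps \<open>W f\<close> such that, for every fixed vector \<open>v\<close>, the squared
  norm of \<open>W f v\<close> is affine in \<open>f\<close> (\<open>affine_norm_maps\<close>). Suitable \<open>c f\<close> exist because each
  positive integer has a positive square multiple that is a sum of four squares. For each \<open>v\<close>, the
  pigeonhole principle on the product set \<open>A\<^bsup>F\<^esup>\<close> and its shifts by multiples of \<open>(W f v)\<close>
  gives a bounded \<open>l \<ge> 1\<close> such that for every \<open>f\<close> translation by \<open>l W f v\<close> keeps a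
  positive proportion of the points of \<open>A\<close> in \<open>A\<close> (\<open>popular_common_shift\<close>). The squared norms of these
  vectors form some \<open>a + t F\<close>, so one of them lies outside \<open>D\<close>. As \<open>v\<close> ranges over about
  \<open>N ^ d\<close> vectors and \<open>W f\<close> is injective, this yields of order \<open>N ^ d\<close> popular differences
  outside \<open>D\<close>, hence of order \<open>|Q|\<^sup>2\<close> pairs.
\<close>

section \<open>Sums of four squares\<close>

definition four_squares :: "int \<Rightarrow> bool" where
  "four_squares n \<longleftrightarrow> (\<exists>a b c d. n = a\<^sup>2 + b\<^sup>2 + c\<^sup>2 + d\<^sup>2)"

lemma euler_four_square_identity:
  fixes q1 :: "'a::comm_ring_1"
  shows "(q1 * c1 - q2 * c2 - q3 * c3 - q4 * c4)\<^sup>2 + (q1 * c2 + q2 * c1 + q3 * c4 - q4 * c3)\<^sup>2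
    + (q1 * c3 - q2 * c4 + q3 * c1 + q4 * c2)\<^sup>2 + (q1 * c4 + q2 * c3 - q3 * c2 + q4 * c1)\<^sup>2
    = (q1\<^sup>2 + q2\<^sup>2 + q3\<^sup>2 + q4\<^sup>2) * (c1\<^sup>2 + c2\<^sup>2 + c3\<^sup>2 + c4\<^sup>2)"
  by (simp add: power2_eq_square algebra_simps)

lemma four_squares_mult:
  assumes "four_squares m" "four_squares n"
  shows "four_squares (m * n)"
  using assms euler_four_square_identity unfolding four_squares_def by metis

lemma four_squares_square: "four_squares (s\<^sup>2)"
  unfolding four_squares_def by (intro exI[of _ s] exI[of _ 0]) simp

text \<open>
  The \<open>(p + 1) / 2\<close> squares and the \<open>(p + 1) / 2\<close> values \<open>- 1 - y\<^sup>2\<close> modulo \<open>p\<close> cannot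
  be disjoint. Taking \<open>x\<close> and \<open>y\<close> below \<open>p / 2\<close> makes the cofactor \<open>k\<close> smaller than \<open>p\<close>,
  which drives the induction below.
\<close>

lemma odd_prime_dvd_two_squares_plus_one:
  assumes "prime (p::int)" "odd p"
  obtains x y k :: int where "0 < k" "k < p" "k * p = x\<^sup>2 + y\<^sup>2 + 1"
proof -
  have p: "p \<ge> 3" using assms prime_ge_2_int[of p] by (cases "p = 2") auto
  define h where "h = (p - 1) div 2"
  have h: "p = 2 * h + 1" "h \<ge> 1" using assms p unfolding h_def by presburger+
  define S where "S = (\<lambda>x. x\<^sup>2 mod p) ` {0..h}"
  define T where "T = (\<lambda>y. (- 1 - y\<^sup>2) mod p) ` {0..h}"
  have eq: "x = y" if "p dvd x\<^sup>2 - y\<^sup>2" "x \<in> {0..h}" "y \<in> {0..h}" for x y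
  proof -
    have "p dvd (x - y) * (x + y)" using that(1) by (simp add: power2_eq_square algebra_simps)
    then have "p dvd x - y \<or> p dvd x + y" using assms(1) prime_dvd_mult_iff by blast
    then show ?thesis
    proof
      assume "p dvd x - y" then show ?thesis using that h zdvd_not_zless[of "\<bar>x - y\<bar>" p] by fastforce
    next
      assume "p dvd x + y" then show ?thesis using that h zdvd_not_zless[of "x + y" p] by fastforce
    qed
  qed
  have "card S = card {0..h}" unfolding S_def
    by (intro card_image inj_onI eq) (simp_all add: mod_eq_dvd_iff)
  moreover have "card T = card {0..h}" unfolding T_def
  proof (intro card_image inj_onI)
    fix x y assume "x \<in> {0..h}" "y \<in> {0..h}" "(- 1 - x\<^sup>2) mod p = (- 1 - y\<^sup>2) mod p"
    then have "p dvd y\<^sup>2 - x\<^sup>2" by (simp add: mod_eq_dvd_iff)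
    with eq[of y x] show "x = y" using \<open>x \<in> _\<close> \<open>y \<in> _\<close> by simp
  qed
  moreover have "card (S \<union> T) \<le> card {0..<p}"
    using p by (intro card_mono) (auto simp: S_def T_def)
  ultimately have "S \<inter> T \<noteq> {}"
    using h card_Un_disjoint[of S T] by (auto simp: S_def T_def)
  then obtain x y where xy: "x \<in> {0..h}" "y \<in> {0..h}" "x\<^sup>2 mod p = (- 1 - y\<^sup>2) mod p"
    unfolding S_def T_def by blast
  then have "p dvd x\<^sup>2 + y\<^sup>2 + 1" by (simp add: mod_eq_dvd_iff algebra_simps)
  then obtain k where k: "k * p = x\<^sup>2 + y\<^sup>2 + 1" by (metis dvdE mult.commute)
  have sq: "x\<^sup>2 \<le> h\<^sup>2" "y\<^sup>2 \<le> h\<^sup>2" using xy by (auto intro: power_mono)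
  have "k * p > 0" using k by (smt (verit) zero_le_power2)
  then have "k > 0" using p by (simp add: zero_less_mult_iff)
  moreover have "k * p < p * p"
  proof -
    have "p * p = 4 * h\<^sup>2 + 4 * h + 1" unfolding h(1) by (simp add: power2_eq_square algebra_simps)
    then show ?thesis using k sq h(2) zero_le_power2[of h] by linarith
  qed
  then have "k < p" using p by simp
  ultimately show ?thesis using that k by blast
qed

text \<open>
  A weak form of Lagrange's theorem, with strong induction on \<open>n\<close> in place of the usual descent: for an
  odd prime \<open>n\<close> with \<open>k n = x\<^sup>2 + y\<^sup>2 + 1\<close> and \<open>s\<^sup>2 k\<close> a sum of four squares, the product
  \<open>(s\<^sup>2 k) (k n) = (s k)\<^sup>2 n\<close> is one too. A square factor is harmless later because the
  progression \<open>a + t F\<close> may be dilated.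
\<close>

lemma square_multiple_four_squares:
  assumes "n > 0"
  shows "\<exists>s>0. four_squares (s\<^sup>2 * int n)"
  using assms
proof (induction n rule: less_induct)
  case (less n)
  consider "n = 1" | "n = 2" | a b where "n = a * b" "a < n" "b < n" "a > 0" "b > 0"
    | "prime n" "odd n"
  proof (cases "prime n")
    case True
    then show ?thesis using that prime_odd_nat[of n] prime_ge_2_nat[of n] by fastforce
  next
    case False
    show ?thesis
    proof (cases "n = 1")
      case True then show ?thesis using that by simp
    next
      case F: False
      then obtain a where a: "a dvd n" "a \<noteq> 1" "a \<noteq> n"
        using False less.prems unfolding prime_nat_iff by auto
      then obtain b where b: "n = a * b" by auto
      have "b > 0" "a > 0" using b less.prems by auto
      moreover have "a < n" using a less.prems by (simp add: dvd_imp_le order_le_neq_trans)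
      moreover have "b < n" using b a \<open>a > 0\<close> \<open>b > 0\<close> by simp
      ultimately show ?thesis using that b by blast
    qed
  qed
  then show ?case
  proof cases
    case 1
    then show ?thesis using four_squares_square[of 1] by (intro exI[of _ 1]) simp
  next
    case 2
    have "(2::int) = 1\<^sup>2 + 1\<^sup>2 + 0\<^sup>2 + 0\<^sup>2" by simp
    then have "four_squares 2" unfolding four_squares_def by blast
    then show ?thesis using 2 by (intro exI[of _ 1]) simp
  next
    case 3
    then obtain s t where st: "s > 0" "t > 0" "four_squares (s\<^sup>2 * int a)" "four_squares (t\<^sup>2 * int b)"
      using less.IH by blast
    from four_squares_mult[OF st(3,4)] have "four_squares ((s * t)\<^sup>2 * int n)"
      using 3 by (simp add: power_mult_distrib ac_simps)
    then show ?thesis using st by (intro exI[of _ "s * t"]) simp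
  next
    case 4
    then obtain x y k where k: "0 < k" "k < int n" "k * int n = x\<^sup>2 + y\<^sup>2 + 1"
      using odd_prime_dvd_two_squares_plus_one[of "int n"] by (metis even_of_nat prime_nat_int_transfer)
    then have "nat k < n" by linarith
    with k obtain s where s: "s > 0" "four_squares (s\<^sup>2 * k)"
      using less.IH[of "nat k"] by auto
    have "four_squares (k * int n)" unfolding four_squares_def k(3)
      by (intro exI[of _ x] exI[of _ y] exI[of _ 1] exI[of _ 0]) simp
    moreover have "(s\<^sup>2 * k) * (k * int n) = (s * k)\<^sup>2 * int n"
      by (simp add: power2_eq_square ac_simps)
    ultimately have "four_squares ((s * k)\<^sup>2 * int n)"
      using four_squares_mult[OF s(2)] by metis
    then show ?thesis using s k by (intro exI[of _ "s * k"]) simp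
  qed
qed

lemma common_square_multiple_four_squares:
  assumes "finite (X :: int set)" "\<And>x. x \<in> X \<Longrightarrow> x > 0"
  shows "\<exists>s>0. \<forall>x\<in>X. four_squares (s\<^sup>2 * x)"
  using assms
proof (induction X rule: finite_induct)
  case empty
  then show ?case by (intro exI[of _ 1]) simp
next
  case (insert x X)
  then obtain s where s: "s > 0" "\<forall>x\<in>X. four_squares (s\<^sup>2 * x)" by auto
  obtain t where t: "t > 0" "four_squares (t\<^sup>2 * x)"
    using square_multiple_four_squares[of "nat x"] insert.prems[of x] by auto
  have "four_squares ((s * t)\<^sup>2 * y)" if "y \<in> insert x X" for y
  proof -
    have "four_squares (s\<^sup>2 * (t\<^sup>2 * y)) \<or> four_squares (t\<^sup>2 * (s\<^sup>2 * y))"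
      using that s t four_squares_mult four_squares_square by auto
    then show ?thesis by (simp add: power_mult_distrib ac_simps)
  qed
  then show ?case using s t by (intro exI[of _ "s * t"]) auto
qed

section \<open>Linear maps with affinely varying norms\<close>

text \<open>
  On four coordinates \<open>W f\<close> is quaternion multiplication by an integer quaternion of norm
  \<open>s\<^sup>2 (f + b)\<close>, and it fixes the other coordinates; hence the squared norm of \<open>W f v\<close> is
  \<open>u + q s\<^sup>2 (f + b)\<close>, where \<open>q\<close> and \<open>u\<close> are the contributions of the two groups of
  coordinates to the squared norm of \<open>v\<close>.
\<close>

lemma affine_norm_maps:
  fixes F :: "int set"
  assumes "CARD('d::finite) \<ge> 4" "finite F"
  shows "\<exists>(m :: nat) (W :: int \<Rightarrow> int ^ 'd \<Rightarrow> int ^ 'd). m \<ge> 1 \<and> (\<forall>f\<in>F. inj (W f)) \<and>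
    (\<forall>f\<in>F. \<forall>v r i. (\<forall>i. \<bar>v $ i\<bar> \<le> r) \<longrightarrow> \<bar>W f v $ i\<bar> \<le> int m * r) \<and>
    (\<forall>v. (\<forall>i. v $ i \<ge> 1) \<longrightarrow> (\<exists>a t. t \<ge> 1 \<and> (\<forall>f\<in>F. sq_dist (W f v) 0 = a + t * f)))"
proof -
  \<comment> \<open>the shift by \<open>b\<close> makes all the numbers \<open>f + b\<close> positive\<close>
  define b where "b = 1 + (\<Sum>f\<in>F. \<bar>f\<bar>)"
  have pos: "f + b > 0" if "f \<in> F" for f
  proof -
    have "\<bar>f\<bar> \<le> (\<Sum>f\<in>F. \<bar>f\<bar>)" using that assms(2) by (intro member_le_sum) auto
    then show ?thesis unfolding b_def by linarith
  qed
  obtain s where s: "s > 0" "\<forall>f\<in>F. four_squares (s\<^sup>2 * (f + b))"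
    using common_square_multiple_four_squares[of "(\<lambda>f. f + b) ` F"] assms(2) pos by auto
  then obtain c1 c2 c3 c4 where
    c: "s\<^sup>2 * (f + b) = (c1 f)\<^sup>2 + (c2 f)\<^sup>2 + (c3 f)\<^sup>2 + (c4 f)\<^sup>2" if "f \<in> F" for f
    unfolding four_squares_def by metis
  obtain j :: "nat \<Rightarrow> 'd" where j: "inj_on j {..<4}"
    using card_le_inj[of "{..<4::nat}" "UNIV :: 'd set"] assms(1) by auto
  define i1 i2 i3 i4 where "i1 = j 0" "i2 = j 1" "i3 = j 2" "i4 = j 3"
  have ne: "i1 \<noteq> i2" "i1 \<noteq> i3" "i1 \<noteq> i4" "i2 \<noteq> i3" "i2 \<noteq> i4" "i3 \<noteq> i4"
    using j unfolding i1_i2_i3_i4_def inj_on_def by force+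
  define W :: "int \<Rightarrow> int ^ 'd \<Rightarrow> int ^ 'd" where "W f v = (\<chi> i.
     if i = i1 then v$i1 * c1 f - v$i2 * c2 f - v$i3 * c3 f - v$i4 * c4 f
     else if i = i2 then v$i1 * c2 f + v$i2 * c1 f + v$i3 * c4 f - v$i4 * c3 f
     else if i = i3 then v$i1 * c3 f - v$i2 * c4 f + v$i3 * c1 f + v$i4 * c2 f
     else if i = i4 then v$i1 * c4 f + v$i2 * c3 f - v$i3 * c2 f + v$i4 * c1 f
     else v $ i)" for f v
  define I where "I = {i1, i2, i3, i4}"
  define q where "q v = (v$i1)\<^sup>2 + (v$i2)\<^sup>2 + (v$i3)\<^sup>2 + (v$i4)\<^sup>2" for v :: "int ^ 'd"
  define u where "u v = (\<Sum>i\<in>-I. (v $ i)\<^sup>2)" for v :: "int ^ 'd"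
  have norm_eq: "sq_dist (W f v) 0 = u v + q v * (s\<^sup>2 * (f + b))" if "f \<in> F" for f v
  proof -
    have "sq_dist (W f v) 0 = (\<Sum>i\<in>I. (W f v $ i)\<^sup>2) + (\<Sum>i\<in>-I. (W f v $ i)\<^sup>2)"
      unfolding sq_dist_def by (subst sum.union_disjoint[symmetric]) (auto simp: Compl_partition)
    also have "(\<Sum>i\<in>-I. (W f v $ i)\<^sup>2) = u v"
      unfolding u_def I_def by (intro sum.cong) (auto simp: W_def)
    also have "(\<Sum>i\<in>I. (W f v $ i)\<^sup>2) = q v * (s\<^sup>2 * (f + b))"
      unfolding c[OF that] q_def euler_four_square_identity[symmetric]
      using ne unfolding I_def by (simp add: W_def)
    finally show ?thesis by simp
  qed
  have inj: "inj (W f)" if f: "f \<in> F" for f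
  proof (rule injI)
    \<comment> \<open>a vector in the kernel of the linear map \<open>W f\<close> has norm zero by \<open>norm_eq\<close>\<close>
    fix v v' assume eq: "W f v = W f v'"
    have "W f (v - v') = W f v - W f v'"
      by (simp add: vec_eq_iff W_def algebra_simps)
    then have "u (v - v') + q (v - v') * (s\<^sup>2 * (f + b)) = 0"
      using norm_eq[OF f, of "v - v'"] eq by (simp add: sq_dist_def)
    moreover have "u (v - v') \<ge> 0" "q (v - v') \<ge> 0" unfolding u_def q_def by (auto intro: sum_nonneg)
    moreover have k: "s\<^sup>2 * (f + b) > 0" using pos[OF f] s by simp
    ultimately have "u (v - v') = 0" "q (v - v') * (s\<^sup>2 * (f + b)) = 0"
      by (smt (verit) mult_nonneg_nonneg)+
    then have z: "u (v - v') = 0" "q (v - v') = 0" using k by auto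
    from z(1) have "\<forall>i\<in>-I. v $ i = v' $ i" unfolding u_def by (subst (asm) sum_nonneg_eq_0_iff) auto
    moreover from z(2) have "\<forall>i\<in>I. v $ i = v' $ i" unfolding q_def I_def
      by (simp add: add_nonneg_eq_0_iff)
    ultimately show "v = v'" unfolding vec_eq_iff by blast
  qed
  define m where "m = nat (1 + (\<Sum>f\<in>F. \<bar>c1 f\<bar> + \<bar>c2 f\<bar> + \<bar>c3 f\<bar> + \<bar>c4 f\<bar>))"
  have S0: "0 \<le> (\<Sum>f\<in>F. \<bar>c1 f\<bar> + \<bar>c2 f\<bar> + \<bar>c3 f\<bar> + \<bar>c4 f\<bar>)" by (intro sum_nonneg) auto
  have bound: "\<bar>W f v $ i\<bar> \<le> int m * r" if f: "f \<in> F" and "\<forall>i. \<bar>v $ i\<bar> \<le> r" for f v r i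
  proof -
    have r: "\<bar>v $ i\<bar> \<le> r" for i using that by blast
    have "\<bar>c1 f\<bar> + \<bar>c2 f\<bar> + \<bar>c3 f\<bar> + \<bar>c4 f\<bar> \<le> (\<Sum>f\<in>F. \<bar>c1 f\<bar> + \<bar>c2 f\<bar> + \<bar>c3 f\<bar> + \<bar>c4 f\<bar>)"
      using f assms(2) by (intro member_le_sum) auto
    then have m: "\<bar>c1 f\<bar> + \<bar>c2 f\<bar> + \<bar>c3 f\<bar> + \<bar>c4 f\<bar> \<le> int m" "1 \<le> int m"
      unfolding m_def using S0 by linarith+
    have r0: "r \<ge> 0" using r[of i] by linarith
    have t: "\<bar>v $ k * c\<bar> \<le> r * \<bar>c\<bar>" for k c
      unfolding abs_mult using r[of k] by (intro mult_right_mono) auto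
    have tri: "\<bar>x\<bar> \<le> \<bar>x1\<bar> + \<bar>x2\<bar> + \<bar>x3\<bar> + \<bar>x4\<bar>"
      if "x \<in> {x1 - x2 - x3 - x4, x1 + x2 + x3 - x4, x1 - x2 + x3 + x4, x1 + x2 - x3 + x4}"
      for x x1 x2 x3 x4 :: int using that by auto
    have "r * (\<bar>c1 f\<bar> + \<bar>c2 f\<bar> + \<bar>c3 f\<bar> + \<bar>c4 f\<bar>) \<le> int m * r" "r * 1 \<le> int m * r"
      using mult_left_mono[OF m(1) r0] mult_left_mono[OF m(2) r0] by (simp_all add: mult.commute)
    then have big: "r * \<bar>c1 f\<bar> + r * \<bar>c2 f\<bar> + r * \<bar>c3 f\<bar> + r * \<bar>c4 f\<bar> \<le> int m * r" "r \<le> int m * r"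
      by (simp_all add: algebra_simps)
    have coords:
      "W f v $ i1 = v$i1 * c1 f - v$i2 * c2 f - v$i3 * c3 f - v$i4 * c4 f"
      "W f v $ i2 = v$i1 * c2 f + v$i2 * c1 f + v$i3 * c4 f - v$i4 * c3 f"
      "W f v $ i3 = v$i1 * c3 f - v$i2 * c4 f + v$i3 * c1 f + v$i4 * c2 f"
      "W f v $ i4 = v$i1 * c4 f + v$i2 * c3 f - v$i3 * c2 f + v$i4 * c1 f"
      using ne unfolding W_def by simp_all
    consider "i = i1" | "i = i2" | "i = i3" | "i = i4" | "i \<notin> I" unfolding I_def by blast
    then show ?thesis
    proof cases
      case 1
      have "\<bar>W f v $ i1\<bar> \<le> \<bar>v$i1 * c1 f\<bar> + \<bar>v$i2 * c2 f\<bar> + \<bar>v$i3 * c3 f\<bar> + \<bar>v$i4 * c4 f\<bar>"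
        unfolding coords by (rule tri) simp
      also have "\<dots> \<le> r * \<bar>c1 f\<bar> + r * \<bar>c2 f\<bar> + r * \<bar>c3 f\<bar> + r * \<bar>c4 f\<bar>"
        by (intro add_mono t)
      also have "\<dots> \<le> int m * r" using big(1) by simp
      finally show ?thesis using 1 by simp
    next
      case 2
      have "\<bar>W f v $ i2\<bar> \<le> \<bar>v$i1 * c2 f\<bar> + \<bar>v$i2 * c1 f\<bar> + \<bar>v$i3 * c4 f\<bar> + \<bar>v$i4 * c3 f\<bar>"
        unfolding coords by (rule tri) simp
      also have "\<dots> \<le> r * \<bar>c2 f\<bar> + r * \<bar>c1 f\<bar> + r * \<bar>c4 f\<bar> + r * \<bar>c3 f\<bar>"
        by (intro add_mono t)
      also have "\<dots> \<le> int m * r" using big(1) by simp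
      finally show ?thesis using 2 by simp
    next
      case 3
      have "\<bar>W f v $ i3\<bar> \<le> \<bar>v$i1 * c3 f\<bar> + \<bar>v$i2 * c4 f\<bar> + \<bar>v$i3 * c1 f\<bar> + \<bar>v$i4 * c2 f\<bar>"
        unfolding coords by (rule tri) simp
      also have "\<dots> \<le> r * \<bar>c3 f\<bar> + r * \<bar>c4 f\<bar> + r * \<bar>c1 f\<bar> + r * \<bar>c2 f\<bar>"
        by (intro add_mono t)
      also have "\<dots> \<le> int m * r" using big(1) by simp
      finally show ?thesis using 3 by simp
    next
      case 4
      have "\<bar>W f v $ i4\<bar> \<le> \<bar>v$i1 * c4 f\<bar> + \<bar>v$i2 * c3 f\<bar> + \<bar>v$i3 * c2 f\<bar> + \<bar>v$i4 * c1 f\<bar>"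
        unfolding coords by (rule tri) simp
      also have "\<dots> \<le> r * \<bar>c4 f\<bar> + r * \<bar>c3 f\<bar> + r * \<bar>c2 f\<bar> + r * \<bar>c1 f\<bar>"
        by (intro add_mono t)
      also have "\<dots> \<le> int m * r" using big(1) by simp
      finally show ?thesis using 4 by simp
    next
      case 5
      then have "W f v $ i = v $ i" unfolding W_def I_def by simp
      then show ?thesis using r[of i] big(2) by linarith
    qed
  qed
  have aff: "\<exists>a t. t \<ge> 1 \<and> (\<forall>f\<in>F. sq_dist (W f v) 0 = a + t * f)" if v: "\<forall>i. v $ i \<ge> 1" for v
  proof (intro exI conjI ballI)
    have "v $ i1 \<ge> 1" using v by blast
    then have "(v $ i1)\<^sup>2 > 0" by simp
    then have "q v > 0" unfolding q_def by (smt (verit) zero_le_power2)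
    then show "q v * s\<^sup>2 \<ge> 1" using s by (smt (verit) mult_pos_pos zero_less_power)
    show "sq_dist (W f v) 0 = (u v + q v * s\<^sup>2 * b) + q v * s\<^sup>2 * f" if "f \<in> F" for f
      using norm_eq[OF that] by (simp add: algebra_simps)
  qed
  have "m \<ge> 1" unfolding m_def using S0 by linarith
  then show ?thesis
    using inj bound aff by (intro exI[of _ m] exI[of _ W] conjI ballI allI impI) assumption+
qed

section \<open>Counting in lattice boxes\<close>

lemma card_vec_all:
  fixes S :: "'a set"
  assumes "finite S"
  shows "finite {x :: 'a ^ 'd::finite. \<forall>i. x $ i \<in> S}"
    and "card {x :: 'a ^ 'd. \<forall>i. x $ i \<in> S} = card S ^ CARD('d)"
proof -
  have eq: "{x :: 'a ^ 'd. \<forall>i. x $ i \<in> S} = vec_lambda ` (PiE UNIV (\<lambda>_. S))"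
  proof (intro equalityI subsetI)
    fix x :: "'a ^ 'd" assume "x \<in> {x. \<forall>i. x $ i \<in> S}"
    then show "x \<in> vec_lambda ` (PiE UNIV (\<lambda>_. S))"
      by (intro image_eqI[of _ _ "vec_nth x"]) (auto simp: vec_nth_inverse)
  qed auto
  show "finite {x :: 'a ^ 'd. \<forall>i. x $ i \<in> S}"
    unfolding eq using assms by (intro finite_imageI finite_PiE) auto
  have "inj_on vec_lambda (PiE (UNIV :: 'd set) (\<lambda>_. S))"
    by (intro inj_onI) (metis vec_lambda_inverse UNIV_I)
  then show "card {x :: 'a ^ 'd. \<forall>i. x $ i \<in> S} = card S ^ CARD('d)"
    unfolding eq by (subst card_image) (simp_all add: card_PiE)
qed

lemma finite_lattice_box: "finite (lattice_box N :: (int ^ 'd::finite) set)"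
  and card_lattice_box: "card (lattice_box N :: (int ^ 'd) set) = (2 * N + 1) ^ CARD('d)"
proof -
  have "(lattice_box N :: (int ^ 'd) set) = {x. \<forall>i. x $ i \<in> {- int N..int N}}"
    unfolding lattice_box_def by (auto simp: abs_le_iff minus_le_iff)
  moreover have "nat (2 * int N + 1) = 2 * N + 1" by linarith
  ultimately show "finite (lattice_box N :: (int ^ 'd) set)"
    "card (lattice_box N :: (int ^ 'd) set) = (2 * N + 1) ^ CARD('d)"
    using card_vec_all[of "{- int N..int N}", where 'd='d] by simp_all
qed

lemma sq_dist_bounds:
  fixes x y :: "int ^ 'd::finite"
  assumes "x \<in> lattice_box N" "y \<in> lattice_box N"
  shows "sq_dist x y \<in> {0..int (4 * CARD('d) * N\<^sup>2)}"
proof -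
  have "(x $ i - y $ i)\<^sup>2 \<le> (2 * int N)\<^sup>2" for i
  proof -
    have "\<bar>x $ i - y $ i\<bar> \<le> 2 * int N"
    proof -
      have "\<bar>x $ i\<bar> \<le> int N" "\<bar>y $ i\<bar> \<le> int N" using assms unfolding lattice_box_def by auto
      then show ?thesis by linarith
    qed
    then show ?thesis by (intro abs_le_square_iff[THEN iffD1]) simp
  qed
  then have "sq_dist x y \<le> (\<Sum>i\<in>(UNIV::'d set). (2 * int N)\<^sup>2)"
    unfolding sq_dist_def by (intro sum_mono)
  then show ?thesis unfolding sq_dist_def by (auto intro: sum_nonneg simp: power_mult_distrib ac_simps)
qed

section \<open>Popular common differences\<close>

text \<open>
  The Bonferroni inequality, with the number of pairs bounded crudely by \<open>k\<^sup>2\<close>.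
\<close>

lemma card_Union_lower_bound:
  fixes E :: "nat \<Rightarrow> 'a set"
  assumes "\<And>i. i < k \<Longrightarrow> finite (E i)" "\<And>i. i < k \<Longrightarrow> real (card (E i)) = e"
    and "\<And>i j. i < j \<Longrightarrow> j < k \<Longrightarrow> real (card (E i \<inter> E j)) \<le> s" "s \<ge> 0"
  shows "real (card (\<Union>i<k. E i)) \<ge> real k * e - (real k)\<^sup>2 * s"
  using assms(1-3)
proof (induction k)
  case (Suc k)
  let ?V = "\<Union>i<k. E i"
  have IH: "real (card ?V) \<ge> real k * e - (real k)\<^sup>2 * s" using Suc by auto
  have "card (?V \<inter> E k) \<le> (\<Sum>i<k. card (E i \<inter> E k))"
    using card_UN_le[of "{..<k}" "\<lambda>i. E i \<inter> E k"] by (simp add: Int_UN_distrib2 Int_commute)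
  then have "real (card (?V \<inter> E k)) \<le> (\<Sum>i<k. real (card (E i \<inter> E k)))"
    by (metis of_nat_le_iff of_nat_sum)
  also have "\<dots> \<le> (\<Sum>i<k. s)" using Suc.prems by (intro sum_mono) auto
  finally have int: "real (card (?V \<inter> E k)) \<le> real k * s" by simp
  have "card ?V + card (E k) = card (?V \<union> E k) + card (?V \<inter> E k)"
    using Suc.prems(1) by (intro card_Un_Int) auto
  then have "real (card (?V \<union> E k)) = real (card ?V) + e - real (card (?V \<inter> E k))"
    using Suc.prems(2)[of k] by linarith
  also have "\<dots> \<ge> real (Suc k) * e - (real k)\<^sup>2 * s - real k * s"
    using IH int by (simp add: algebra_simps)
  finally have "real (card (?V \<union> E k)) \<ge> real (Suc k) * e - ((real k)\<^sup>2 + real k) * s"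
    by (simp add: algebra_simps)
  moreover have "((real k)\<^sup>2 + real k) * s \<le> (real (Suc k))\<^sup>2 * s"
    using assms(4) by (intro mult_right_mono) (auto simp: power2_eq_square algebra_simps)
  moreover have "(\<Union>i<Suc k. E i) = ?V \<union> E k" by (auto simp: lessThan_Suc)
  ultimately show ?case by simp
qed simp

text \<open>
  Passing to the product set \<open>A\<^bsup>F\<^esup>\<close> turns the wish for one pair \<open>i < j\<close> serving all \<open>f\<close> at
  once into a single intersection: too many translates of \<open>A\<^bsup>F\<^esup>\<close> inside \<open>U\<^bsup>F\<^esup>\<close> cannot be
  almost disjoint, and the intersection of two translates is a product over \<open>f\<close> in which a large
  product forces every factor to be large.
\<close>

lemma popular_common_shift:
  fixes u :: "nat \<Rightarrow> 'b \<Rightarrow> 'a::ab_group_add" and A U :: "'a set"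
  assumes fin: "finite A" "finite U" "finite F"
    and sub: "\<And>i f x. i < k \<Longrightarrow> f \<in> F \<Longrightarrow> x \<in> A \<Longrightarrow> x + u i f \<in> U"
    and big: "2 * real (card U) ^ card F < real k * real (card A) ^ card F"
  shows "\<exists>i j. i < j \<and> j < k \<and> (\<forall>f\<in>F. (real k)\<^sup>2 * real (card {x\<in>A. x + (u j f - u i f) \<in> A}) \<ge> card A)"
proof -
  define S where "S i f = (\<lambda>x. x + u i f) ` A" for i f
  define E where "E i = PiE F (S i)" for i
  define R where "R i j f = {x\<in>A. x + (u j f - u i f) \<in> A}" for i j f
  let ?h = "card F"
  \<comment> \<open>if no \<open>E i \<inter> E j\<close> had more than \<open>s\<close> elements, the union would not fit into \<open>U\<^bsup>F\<^esup>\<close>\<close>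
  define s where "s = real (card U) ^ ?h / (real k)\<^sup>2"
  have k: "k > 0" using big by (cases "k = 0") (auto simp: not_less)
  have cS: "card (S i f) = card A" for i f unfolding S_def by (intro card_image inj_onI) simp
  have fS: "finite (S i f)" for i f unfolding S_def using fin by simp
  have fE: "finite (E i)" for i unfolding E_def using fin fS by (intro finite_PiE) auto
  have cE: "real (card (E i)) = real (card A) ^ ?h" for i
    unfolding E_def using fin by (simp add: card_PiE cS)
  have "(\<Union>i<k. E i) \<subseteq> PiE F (\<lambda>_. U)"
    unfolding E_def S_def using sub by (intro UN_least PiE_mono) auto
  then have "card (\<Union>i<k. E i) \<le> card (PiE F (\<lambda>_. U))"
    using fin by (intro card_mono finite_PiE) auto
  then have cU: "real (card (\<Union>i<k. E i)) \<le> real (card U) ^ ?h"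
    using fin by (simp add: card_PiE flip: of_nat_power)
  have "\<exists>i j. i < j \<and> j < k \<and> real (card (E i \<inter> E j)) > s"
  proof (rule ccontr)
    assume "\<not> ?thesis"
    then have small: "real (card (E i \<inter> E j)) \<le> s" if "i < j" "j < k" for i j
      using that by (meson not_less)
    have "s \<ge> 0" unfolding s_def by simp
    then have "real (card (\<Union>i<k. E i)) \<ge> real k * real (card A) ^ ?h - (real k)\<^sup>2 * s"
      by (intro card_Union_lower_bound fE cE small)
    moreover have "(real k)\<^sup>2 * s = real (card U) ^ ?h" unfolding s_def using k by simp
    ultimately show False using cU big by linarith
  qed
  then obtain i j where ij: "i < j" "j < k" "real (card (E i \<inter> E j)) > s" by blast
  have cR: "card (S i f \<inter> S j f) = card (R i j f)" for f
  proof -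
    have "S i f \<inter> S j f = (\<lambda>x. x + u j f) ` R i j f"
    proof (intro equalityI subsetI)
      fix z assume "z \<in> S i f \<inter> S j f"
      then obtain x y where xy: "x \<in> A" "y \<in> A" "z = x + u i f" "z = y + u j f"
        unfolding S_def by auto
      then have "x = y + (u j f - u i f)" by (simp add: algebra_simps)
      then show "z \<in> (\<lambda>x. x + u j f) ` R i j f" using xy unfolding R_def by blast
    next
      fix z assume "z \<in> (\<lambda>x. x + u j f) ` R i j f"
      then obtain y where y: "y \<in> A" "y + (u j f - u i f) \<in> A" "z = y + u j f" unfolding R_def by auto
      then have "z = (y + (u j f - u i f)) + u i f" by (simp add: algebra_simps)
      then show "z \<in> S i f \<inter> S j f" using y unfolding S_def by blast
    qed
    then show ?thesis by (simp add: card_image)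
  qed
  have "E i \<inter> E j = PiE F (\<lambda>f. S i f \<inter> S j f)" unfolding E_def PiE_Int ..
  then have prodR: "(\<Prod>f\<in>F. real (card (R i j f))) > s"
    using ij(3) fin by (simp add: card_PiE cR)
  have RA: "card (R i j f) \<le> card A" for f unfolding R_def using fin by (intro card_mono) auto
  have "(real k)\<^sup>2 * real (card (R i j f)) \<ge> card A" if f: "f \<in> F" for f
  proof (cases "card A = 0")
    case False
    have "A \<noteq> {}" using False by auto
    then have "card ((\<lambda>x. x + u i f) ` A) \<le> card U"
      using sub[of i f] ij f fin by (intro card_mono) auto
    then have AU: "card A \<le> card U" using cS[of i f] unfolding S_def by simp
    have h: "?h = Suc (card (F - {f}))" by (rule card.remove[OF fin(3) f])
    have "real (card A) ^ ?h \<le> real (card U) ^ ?h" using AU by (intro power_mono) auto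
    also have "\<dots> = (real k)\<^sup>2 * s" unfolding s_def using k by simp
    also have "\<dots> \<le> (real k)\<^sup>2 * (\<Prod>f\<in>F. real (card (R i j f)))"
      using prodR by (intro mult_left_mono) auto
    also have "(\<Prod>f\<in>F. real (card (R i j f))) = real (card (R i j f)) * (\<Prod>f\<in>F-{f}. real (card (R i j f)))"
      by (rule prod.remove[OF fin(3) f])
    also have "(real k)\<^sup>2 * \<dots> \<le> (real k)\<^sup>2 * (real (card (R i j f)) * (\<Prod>f\<in>F-{f}. real (card A)))"
      using RA by (intro mult_left_mono prod_mono) auto
    finally have "real (card A) * real (card A) ^ card (F - {f}) \<le>
        ((real k)\<^sup>2 * real (card (R i j f))) * real (card A) ^ card (F - {f})"
      unfolding h by (simp add: mult.assoc)
    then show ?thesis using False by simp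
  qed simp
  then show ?thesis using ij unfolding R_def by blast
qed

section \<open>Supersaturation for distances outside a set\<close>

text \<open>
  Every vector \<open>v\<close> with positive coordinates bounded by a small multiple of \<open>N\<close> produces a
  popular difference \<open>l W f v\<close> of \<open>A\<close> with squared norm outside \<open>D\<close>. The number of choices of
  \<open>(l, f)\<close> is bounded, and for each of them \<open>v\<close> is determined by the difference, so
  the set \<open>Z\<close> of these differences has size of order \<open>N ^ d\<close>.
\<close>

lemma affine_avoiding_supersaturation:
  fixes F :: "int set" and \<alpha> :: real
  assumes "CARD('d::finite) \<ge> 4" "finite F" "\<alpha> > 0"
  shows "\<exists>\<beta>>0. \<forall>\<^sub>F N in sequentially. \<forall>D A.
    (\<forall>a t. t \<ge> (1::nat) \<longrightarrow> \<not> (\<lambda>f. a + int t * f) ` F \<subseteq> D) \<longrightarrow>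
    A \<subseteq> (lattice_box N :: (int ^ 'd) set) \<longrightarrow>
    real (card A) \<ge> \<alpha> * real (card (lattice_box N :: (int ^ 'd) set)) \<longrightarrow>
    real (card {(x, y) \<in> A \<times> A. sq_dist x y \<notin> D}) \<ge> \<beta> * (real (card (lattice_box N :: (int ^ 'd) set)))\<^sup>2"
proof -
  let ?d = "CARD('d)" and ?h = "card F"
  obtain m :: nat and W :: "int \<Rightarrow> int ^ 'd \<Rightarrow> int ^ 'd" where
    m: "m \<ge> 1" and inj: "\<forall>f\<in>F. inj (W f)"
    and bound: "\<forall>f\<in>F. \<forall>v r i. (\<forall>i. \<bar>v $ i\<bar> \<le> r) \<longrightarrow> \<bar>W f v $ i\<bar> \<le> int m * r"
    and aff: "\<forall>v. (\<forall>i. v $ i \<ge> 1) \<longrightarrow> (\<exists>a t. t \<ge> 1 \<and> (\<forall>f\<in>F. sq_dist (W f v) 0 = a + t * f))"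
    using affine_norm_maps[OF assms(1,2)] by (elim exE conjE) (rule that)
  \<comment> \<open>the shifted copies of \<open>A\<close> lie in a box of size at most \<open>2 ^ d\<close> times that of the original one\<close>
  obtain k :: nat where k: "real k > 2 * (2 ^ ?d) ^ ?h / \<alpha> ^ ?h"
    using reals_Archimedean2 by blast
  have k0: "k > 0"
  proof (rule ccontr)
    assume "\<not> 0 < k"
    moreover have "2 * (2 ^ ?d) ^ ?h / \<alpha> ^ ?h > 0" using assms(3) by simp
    ultimately show False using k by simp
  qed
  have k': "2 * (2 ^ ?d) ^ ?h < real k * \<alpha> ^ ?h" using k assms(3) by (simp add: field_simps)
  define C where "C = real k * real (?h + 1) * (6 * real k * real m) ^ ?d"
  have C: "C > 0" unfolding C_def using k0 m by simp
  define \<beta> where "\<beta> = \<alpha> / ((real k)\<^sup>2 * C)"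
  have "\<beta> > 0" unfolding \<beta>_def using assms(3) k0 C by simp
  moreover have "\<forall>\<^sub>F N in sequentially. N \<ge> k * m" by (rule eventually_ge_at_top)
  then have "\<forall>\<^sub>F N in sequentially. \<forall>D A.
    (\<forall>a t. t \<ge> (1::nat) \<longrightarrow> \<not> (\<lambda>f. a + int t * f) ` F \<subseteq> D) \<longrightarrow>
    A \<subseteq> (lattice_box N :: (int ^ 'd) set) \<longrightarrow>
    real (card A) \<ge> \<alpha> * real (card (lattice_box N :: (int ^ 'd) set)) \<longrightarrow>
    real (card {(x, y) \<in> A \<times> A. sq_dist x y \<notin> D}) \<ge> \<beta> * (real (card (lattice_box N :: (int ^ 'd) set)))\<^sup>2"
  proof (eventually_elim, intro allI impI)
    fix N :: nat and D :: "int set" and A :: "(int ^ 'd) set"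
    assume N: "k * m \<le> N"
      and D: "\<forall>a t. t \<ge> (1::nat) \<longrightarrow> \<not> (\<lambda>f. a + int t * f) ` F \<subseteq> D"
      and A: "A \<subseteq> lattice_box N" "real (card A) \<ge> \<alpha> * real (card (lattice_box N :: (int ^ 'd) set))"
    define n where "n = card (lattice_box N :: (int ^ 'd) set)"
    have n: "n = (2 * N + 1) ^ ?d" unfolding n_def by (rule card_lattice_box)
    have n0: "n > 0" unfolding n by simp
    have finA: "finite A" using A(1) finite_lattice_box finite_subset by blast
    have An: "real (card A) \<ge> \<alpha> * real n" using A(2) unfolding n_def .
    have "\<alpha> * real n > 0" using assms(3) n0 by simp
    then have A0: "card A > 0" using An by linarith
    \<comment> \<open>the largest scale at which all shifts \<open>i W f v\<close> with \<open>i < k\<close> stay within \<open>N\<close>\<close>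
    define r where "r = N div (k * m)"
    have km: "k * m > 0" using k0 m by simp
    have r1: "r \<ge> 1" unfolding r_def using N km by (simp add: div_greater_zero_iff Suc_le_eq)
    have rN: "k * m * r \<le> N" unfolding r_def by simp
    have "N < k * m * (r + 1)" unfolding r_def using km
      by (metis dividend_less_div_times add.commute mult.commute mult_Suc_right Suc_eq_plus1)
    also have "\<dots> \<le> k * m * (2 * r)" using r1 by (intro mult_le_mono2) simp
    finally have N6: "2 * N + 1 \<le> 6 * k * m * r" by simp
    define P where "P = {v :: int ^ 'd. \<forall>i. v $ i \<in> {1..int r}}"
    have finP: "finite P" and cP: "card P = r ^ ?d"
      unfolding P_def using card_vec_all[of "{1..int r}", where 'd='d] by simp_all
    have "real n \<le> real ((6 * k * m * r) ^ ?d)"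
      unfolding n of_nat_le_iff using N6 by (intro power_mono) auto
    then have nP: "real n \<le> (6 * real k * real m) ^ ?d * real (card P)"
      unfolding cP by (simp add: power_mult_distrib)
    define Z where "Z = {z. sq_dist z 0 \<notin> D \<and> (real k)\<^sup>2 * real (card {x\<in>A. x + z \<in> A}) \<ge> card A}"
    have finZ: "finite Z"
    proof (rule finite_subset)
      show "Z \<subseteq> (\<lambda>(x, y). y - x) ` (A \<times> A)"
      proof
        fix z assume "z \<in> Z"
        then have "real (card A) \<le> (real k)\<^sup>2 * real (card {x\<in>A. x + z \<in> A})"
          unfolding Z_def by blast
        then have "card {x\<in>A. x + z \<in> A} \<noteq> 0" using A0 by (intro notI) simp
        then have "{x\<in>A. x + z \<in> A} \<noteq> {}" by (intro notI) simp
        then obtain x where "x \<in> A" "x + z \<in> A" by blast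
        then show "z \<in> (\<lambda>(x, y). y - x) ` (A \<times> A)" by (intro image_eqI[of _ _ "(x, x + z)"]) auto
      qed
      show "finite ((\<lambda>(x, y). y - x) ` (A \<times> A))" using finA by simp
    qed
    have hit: "\<exists>l\<in>{1..<k}. \<exists>f\<in>F. int l *s W f v \<in> Z" if v: "v \<in> P" for v
    proof -
      have vi: "1 \<le> v $ i" "v $ i \<le> int r" for i using v unfolding P_def by auto
      have v1: "\<forall>i. v $ i \<ge> 1" using vi by blast
      have "\<bar>v $ i\<bar> \<le> int r" for i using vi[of i] by linarith
      then have vr: "\<forall>i. \<bar>v $ i\<bar> \<le> int r" by blast
      obtain a t where at: "t \<ge> 1" "\<forall>f\<in>F. sq_dist (W f v) 0 = a + t * f" using aff v1 by blast
      have "\<exists>i j. i < j \<and> j < k \<and>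
         (\<forall>f\<in>F. (real k)\<^sup>2 * real (card {x\<in>A. x + (int j *s W f v - int i *s W f v) \<in> A}) \<ge> card A)"
      proof (rule popular_common_shift[where U = "lattice_box (2 * N)"])
        fix i f x assume i: "i < k" and f: "f \<in> F" and x: "x \<in> A"
        have "\<bar>(x + int i *s W f v) $ c\<bar> \<le> int (2 * N)" for c
        proof -
          have "\<bar>int i * W f v $ c\<bar> \<le> int k * (int m * int r)"
            unfolding abs_mult using i bound f vr by (intro mult_mono) auto
          also have "\<dots> \<le> int N" using rN by (metis mult.assoc of_nat_le_iff of_nat_mult)
          moreover have "\<bar>x $ c\<bar> \<le> int N" using x A(1) unfolding lattice_box_def by auto
          ultimately show ?thesis by simp
        qed
        then show "x + int i *s W f v \<in> lattice_box (2 * N)" unfolding lattice_box_def by blast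
      next
        have "card (lattice_box (2 * N) :: (int ^ 'd) set) \<le> (2 * (2 * N + 1)) ^ ?d"
          unfolding card_lattice_box by (intro power_mono) auto
        then have "real (card (lattice_box (2 * N) :: (int ^ 'd) set)) \<le> 2 ^ ?d * real n"
          unfolding n power_mult_distrib by (metis of_nat_le_iff of_nat_mult of_nat_numeral of_nat_power)
        then have "2 * real (card (lattice_box (2 * N) :: (int ^ 'd) set)) ^ ?h \<le> 2 * (2 ^ ?d * real n) ^ ?h"
          by (intro mult_left_mono power_mono) auto
        also have "\<dots> = (2 * (2 ^ ?d) ^ ?h) * real n ^ ?h" by (simp add: power_mult_distrib)
        also have "\<dots> < (real k * \<alpha> ^ ?h) * real n ^ ?h"
          using k' n0 by (intro mult_strict_right_mono) auto
        also have "\<dots> = real k * (\<alpha> * real n) ^ ?h" by (simp add: power_mult_distrib)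
        also have "\<dots> \<le> real k * real (card A) ^ ?h"
          using An assms(3) by (intro mult_left_mono power_mono) auto
        finally show "2 * real (card (lattice_box (2 * N) :: (int ^ 'd) set)) ^ ?h < real k * real (card A) ^ ?h" .
      qed (use finA assms(2) finite_lattice_box in auto)
      then obtain i j where ij: "i < j" "j < k"
        "\<forall>f\<in>F. (real k)\<^sup>2 * real (card {x\<in>A. x + (int j *s W f v - int i *s W f v) \<in> A}) \<ge> card A"
        by blast
      define l where "l = j - i"
      have l: "l \<in> {1..<k}" unfolding l_def using ij by auto
      have diff: "int j *s W f v - int i *s W f v = int l *s W f v" for f
        unfolding l_def using ij by (simp add: vec_eq_iff algebra_simps of_nat_diff)
      \<comment> \<open>dilating by \<open>l\<close> multiplies the progression by \<open>l\<^sup>2\<close>, and some member of it escapes \<open>D\<close>\<close>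
      have "1 * 1 \<le> (int l)\<^sup>2 * t" using l at(1) by (intro mult_mono one_le_power) auto
      then have "nat ((int l)\<^sup>2 * t) \<ge> 1" by linarith
      then obtain f where f: "f \<in> F" "(int l)\<^sup>2 * a + int (nat ((int l)\<^sup>2 * t)) * f \<notin> D"
        using D by blast
      have "sq_dist (int l *s W f v) 0 = (int l)\<^sup>2 * sq_dist (W f v) 0"
        unfolding sq_dist_def by (simp add: power_mult_distrib sum_distrib_left)
      also have "\<dots> = (int l)\<^sup>2 * a + int (nat ((int l)\<^sup>2 * t)) * f"
        using at f(1) by (simp add: algebra_simps)
      finally have "int l *s W f v \<in> Z" unfolding Z_def using f ij(3) diff by simp
      then show ?thesis using l f(1) by blast
    qed
    define I where "I = {1..<k} \<times> F"
    define T where "T lf = (\<lambda>v. int (fst lf) *s W (snd lf) v) -` Z" for lf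
    have finI: "finite I" unfolding I_def using assms(2) by simp
    have T: "finite (T lf) \<and> card (T lf) \<le> card Z" if lf: "lf \<in> I" for lf
    proof -
      have "inj (\<lambda>v. int (fst lf) *s W (snd lf) v)"
      proof (rule injI)
        fix v v' assume "int (fst lf) *s W (snd lf) v = int (fst lf) *s W (snd lf) v'"
        then have "int (fst lf) * W (snd lf) v $ i = int (fst lf) * W (snd lf) v' $ i" for i
          by (metis vector_smult_component)
        moreover have "int (fst lf) \<noteq> 0" using lf unfolding I_def by auto
        ultimately have "W (snd lf) v = W (snd lf) v'" by (simp add: vec_eq_iff)
        moreover have "inj (W (snd lf))" using inj lf unfolding I_def by auto
        ultimately show "v = v'" by (simp add: inj_eq)
      qed
      from finite_vimageI[OF finZ this] card_vimage_inj_on_le[OF this finZ]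
      show ?thesis unfolding T_def by simp
    qed
    have "P \<subseteq> (\<Union>lf\<in>I. T lf)"
    proof
      fix v assume "v \<in> P"
      then obtain l f where "l \<in> {1..<k}" "f \<in> F" "int l *s W f v \<in> Z" using hit by blast
      then have "(l, f) \<in> I" "v \<in> T (l, f)" unfolding I_def T_def by simp_all
      then show "v \<in> (\<Union>lf\<in>I. T lf)" by blast
    qed
    then have "card P \<le> card (\<Union>lf\<in>I. T lf)"
      using finI T by (intro card_mono) auto
    also have "\<dots> \<le> (\<Sum>lf\<in>I. card (T lf))"
      by (rule card_UN_le[OF finI])
    also have "\<dots> \<le> (\<Sum>lf\<in>I. card Z)"
      using T by (intro sum_mono) auto
    also have "\<dots> = (k - 1) * ?h * card Z" unfolding I_def by (simp add: card_cartesian_product)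
    also have "\<dots> \<le> k * (?h + 1) * card Z" by (intro mult_le_mono) auto
    finally have PZ: "real (card P) \<le> real k * real (?h + 1) * real (card Z)"
      by (metis of_nat_le_iff of_nat_mult)
    have nZ: "real n \<le> C * real (card Z)"
      using order_trans[OF nP mult_left_mono[OF PZ]] unfolding C_def by (simp add: ac_simps)
    define Ed where "Ed = {(x, y) \<in> A \<times> A. sq_dist x y \<notin> D}"
    have "card (SIGMA z:Z. {x\<in>A. x + z \<in> A}) \<le> card Ed"
    proof (rule card_inj_on_le)
      show "inj_on (\<lambda>(z, x). (x, x + z)) (SIGMA z:Z. {x\<in>A. x + z \<in> A})"
        by (auto simp: inj_on_def)
      have "sq_dist x (x + z) = sq_dist z 0" for x z :: "int ^ 'd"
        unfolding sq_dist_def by simp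
      then show "(\<lambda>(z, x). (x, x + z)) ` (SIGMA z:Z. {x\<in>A. x + z \<in> A}) \<subseteq> Ed"
        unfolding Ed_def Z_def by auto
      show "finite Ed" unfolding Ed_def using finA by (auto intro: finite_subset[of _ "A \<times> A"])
    qed
    then have "(\<Sum>z\<in>Z. real (card {x\<in>A. x + z \<in> A})) \<le> real (card Ed)"
      using finZ finA by (simp flip: of_nat_sum)
    then have "(real k)\<^sup>2 * (\<Sum>z\<in>Z. real (card {x\<in>A. x + z \<in> A})) \<le> (real k)\<^sup>2 * real (card Ed)"
      by (intro mult_left_mono) auto
    moreover have "(\<Sum>z\<in>Z. real (card A)) \<le> (\<Sum>z\<in>Z. (real k)\<^sup>2 * real (card {x\<in>A. x + z \<in> A}))"
      by (intro sum_mono) (auto simp: Z_def)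
    ultimately have "real (card Z) * real (card A) \<le> (real k)\<^sup>2 * real (card Ed)"
      by (simp add: sum_distrib_left)
    moreover have "real (card Z) * (\<alpha> * real n) \<le> real (card Z) * real (card A)"
      using An by (intro mult_left_mono) auto
    moreover have "real n * (\<alpha> * real n) \<le> C * real (card Z) * (\<alpha> * real n)"
      using nZ assms(3) by (intro mult_right_mono) auto
    ultimately have "\<alpha> * (real n)\<^sup>2 \<le> C * ((real k)\<^sup>2 * real (card Ed))"
      using C by (smt (verit) mult_left_mono mult.assoc mult.commute power2_eq_square)
    then have "\<beta> * (real n)\<^sup>2 \<le> real (card Ed)"
      unfolding \<beta>_def using C k0 by (simp add: field_simps)
    then show "real (card {(x, y) \<in> A \<times> A. sq_dist x y \<notin> D}) \<ge> \<beta> * (real (card (lattice_box N :: (int ^ 'd) set)))\<^sup>2"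
      unfolding Ed_def n_def .
  qed
  ultimately show ?thesis by blast
qed

section \<open>Containers for cliques\<close>

text \<open>
  Each round removes at least \<open>m\<close> points from \<open>C\<close>. Supersaturation provides a set \<open>H\<close> of at
  least \<open>m\<close> vertices having at least \<open>m\<close> non-neighbours in \<open>C\<close>. A clique \<open>B\<close> either misses
  \<open>H\<close>, which can then be discarded, or contains some \<open>v \<in> H\<close>, and the non-neighbours of
  \<open>v\<close> can be discarded. The branching over these at most \<open>|Q| + 1\<close> cases gives the bound on the
  number of containers.
\<close>

lemma clique_containers:
  fixes Q :: "'a set" and R :: "'a \<Rightarrow> 'a \<Rightarrow> bool" and s m :: real
  assumes finQ: "finite Q" and "m > 0" and s: "s \<ge> 0"
    and super: "\<And>A. A \<subseteq> Q \<Longrightarrow> real (card A) > s \<Longrightarrow>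
        real (card {(x, y) \<in> A \<times> A. \<not> R x y}) \<ge> 2 * m * real (card Q)"
    and "C \<subseteq> Q" "real (card C) \<le> s + real j * m"
  shows "\<exists>\<C>. finite \<C> \<and> card \<C> \<le> (card Q + 1) ^ j \<and> (\<forall>X\<in>\<C>. X \<subseteq> Q \<and> real (card X) \<le> s) \<and>
    (\<forall>B\<subseteq>C. (\<forall>x\<in>B. \<forall>y\<in>B. R x y) \<longrightarrow> (\<exists>X\<in>\<C>. B \<subseteq> X))"
  using assms(5,6)
proof (induction j arbitrary: C)
  case 0
  then show ?case by (intro exI[of _ "{C}"]) auto
next
  case (Suc j)
  show ?case
  proof (cases "real (card C) \<le> s")
    case True
    have "card {C} \<le> (card Q + 1) ^ Suc j" 
      using one_le_power[of "card Q + 1" "Suc j"] by (simp del: power_Suc)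
    then show ?thesis using True Suc.prems by (intro exI[of _ "{C}"]) auto
  next
    case False
    have finC: "finite C" using Suc.prems(1) finQ finite_subset by blast
    have CQ: "card C \<le> card Q" using Suc.prems(1) finQ by (rule card_mono[rotated])
    have Q0: "card Q > 0"
    proof (rule ccontr)
      assume "\<not> 0 < card Q"
      then have "C = {}" using Suc.prems(1) finQ by auto
      then show False using s False by simp
    qed
    define nb where "nb x = {y\<in>C. \<not> R x y}" for x
    define H where "H = {x\<in>C. real (card (nb x)) \<ge> m}"
    have HC: "H \<subseteq> C" "finite H" unfolding H_def using finC by auto
    have "{(x, y) \<in> C \<times> C. \<not> R x y} = (SIGMA x:C. nb x)" unfolding nb_def by auto
    then have "real (card {(x, y) \<in> C \<times> C. \<not> R x y}) = (\<Sum>x\<in>C. real (card (nb x)))"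
      using finC by (simp add: nb_def)
    also have "\<dots> = (\<Sum>x\<in>H. real (card (nb x))) + (\<Sum>x\<in>C-H. real (card (nb x)))"
      using HC finC by (simp add: sum.subset_diff add.commute)
    also have "(\<Sum>x\<in>H. real (card (nb x))) \<le> (\<Sum>x\<in>H. real (card Q))"
    proof (intro sum_mono)
      fix x show "real (card (nb x)) \<le> real (card Q)"
        using card_mono[OF finC, of "nb x"] CQ unfolding nb_def by auto
    qed
    also have "(\<Sum>x\<in>C-H. real (card (nb x))) \<le> (\<Sum>x\<in>C-H. m)"
      unfolding H_def by (intro sum_mono) auto
    also have "(\<Sum>x\<in>C-H. m) \<le> real (card Q) * m"
      using card_mono[OF finC, of "C - H"] CQ assms(2) by (simp add: mult_right_mono)
    finally have "real (card Q) * (2 * m) \<le> real (card Q) * (real (card H) + m)"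
      using super[OF Suc.prems(1)] False by (simp add: algebra_simps)
    then have mH: "m \<le> real (card H)" using Q0 by simp
    have step: "real (card (C - Y)) \<le> s + real j * m" if "Y \<subseteq> C" "m \<le> real (card Y)" for Y
    proof -
      have "card (C - Y) + card Y = card C"
        using that(1) finC by (metis card_mono card_Diff_subset finite_subset le_add_diff_inverse2)
      then show ?thesis using that(2) Suc.prems(2) by (simp add: algebra_simps)
    qed
    define good where "good C' \<C> \<longleftrightarrow> finite \<C> \<and> card \<C> \<le> (card Q + 1) ^ j \<and>
      (\<forall>X\<in>\<C>. X \<subseteq> Q \<and> real (card X) \<le> s) \<and>
      (\<forall>B\<subseteq>C'. (\<forall>x\<in>B. \<forall>y\<in>B. R x y) \<longrightarrow> (\<exists>X\<in>\<C>. B \<subseteq> X))" for C' \<C>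
    have ex: "\<exists>\<C>. good (C - Y) \<C>" if "Y \<subseteq> C" "m \<le> real (card Y)" for Y
      unfolding good_def using step[OF that] Suc.prems(1) by (intro Suc.IH) auto
    obtain \<C>0 where \<C>0: "good (C - H) \<C>0" using ex[OF HC(1) mH] by blast
    have "\<exists>\<C>. good (C - nb v) \<C>" if "v \<in> H" for v
      using that by (intro ex) (auto simp: H_def nb_def)
    then obtain \<C>1 where \<C>1: "\<And>v. v \<in> H \<Longrightarrow> good (C - nb v) (\<C>1 v)" by metis
    let ?\<C> = "\<C>0 \<union> (\<Union>v\<in>H. \<C>1 v)"
    have "card ?\<C> \<le> card \<C>0 + card (\<Union>v\<in>H. \<C>1 v)" by (rule card_Un_le)
    also have "card (\<Union>v\<in>H. \<C>1 v) \<le> (\<Sum>v\<in>H. card (\<C>1 v))" using HC by (intro card_UN_le)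
    also have "(\<Sum>v\<in>H. card (\<C>1 v)) \<le> (\<Sum>v\<in>H. (card Q + 1) ^ j)"
      using \<C>1 unfolding good_def by (intro sum_mono) auto
    also have "(\<Sum>v\<in>H. (card Q + 1) ^ j) \<le> card Q * (card Q + 1) ^ j"
      using card_mono[OF finC HC(1)] CQ by simp
    also have "card \<C>0 \<le> (card Q + 1) ^ j" using \<C>0 unfolding good_def by simp
    finally have "card ?\<C> \<le> (card Q + 1) ^ Suc j" by simp
    moreover have "\<exists>X\<in>?\<C>. B \<subseteq> X" if B: "B \<subseteq> C" "\<forall>x\<in>B. \<forall>y\<in>B. R x y" for B
    proof (cases "B \<inter> H = {}")
      case True
      then have "B \<subseteq> C - H" using B(1) by blast
      then show ?thesis using \<C>0 B(2) unfolding good_def by blast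
    next
      case False
      then obtain v where v: "v \<in> B" "v \<in> H" by blast
      then have "B \<subseteq> C - nb v" using B unfolding nb_def by blast
      then show ?thesis using \<C>1[OF v(2)] B(2) v(2) unfolding good_def by blast
    qed
    moreover have "finite ?\<C>" using \<C>0 \<C>1 HC unfolding good_def by auto
    moreover have "X \<subseteq> Q \<and> real (card X) \<le> s" if "X \<in> ?\<C>" for X
      using that \<C>0 \<C>1 unfolding good_def by auto
    ultimately show ?thesis by (intro exI[of _ ?\<C>] conjI ballI allI impI) auto
  qed
qed

section \<open>A Chernoff bound for random subsets\<close>

lemma exp_le_quadratic:
  fixes x :: real
  assumes "x \<le> 1"
  shows "exp x \<le> 1 + x + x\<^sup>2"
proof (cases "x \<ge> 0")
  case True
  then show ?thesis using exp_bound assms by blast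
next
  case False
  have "1 - x \<le> exp (- x)" using exp_ge_add_one_self[of "- x"] by simp
  then have "exp x \<le> 1 / (1 - x)" using False by (simp add: exp_minus field_simps)
  also have "\<dots> \<le> 1 + x + x\<^sup>2"
  proof -
    have "(1 + x + x\<^sup>2) * (1 - x) = 1 - x ^ 3" by (simp add: power2_eq_square power3_eq_cube algebra_simps)
    moreover have "x ^ 3 \<le> 0" using False by (simp add: power_le_zero_eq)
    ultimately show ?thesis using False by (simp add: pos_divide_le_eq)
  qed
  finally show ?thesis .
qed

text \<open>
  The exponential moment of \<open>card (\<Omega> \<inter> C) - \<delta> * card \<Omega>\<close> controls the random sizes of
  \<open>\<Omega> \<inter> C\<close> and \<open>\<Omega>\<close> together: it is a product over the points of \<open>Q\<close>, where a point has
  weight \<open>1 - \<delta>\<close> or \<open>- \<delta>\<close> according to whether it lies in \<open>C\<close>.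
\<close>

lemma binomial_subset_relative_upper_tail:
  fixes Q C :: "'a set"
  assumes Q: "finite Q" "C \<subseteq> Q" and p: "0 \<le> p" "p \<le> 1" and \<delta>: "0 < \<delta>" "\<delta> < 1"
    and C: "real (card C) \<le> \<delta> / 2 * real (card Q)"
  shows "measure_pmf.prob (binomial_subset Q p) {\<Omega>. \<delta> * real (card \<Omega>) \<le> real (card (\<Omega> \<inter> C))}
    \<le> exp (- (\<delta>\<^sup>2 / 16) * (p * real (card Q)))"
proof -
  \<comment> \<open>nearly optimal: the exponent is about \<open>p |Q| (\<theta>\<^sup>2 - \<theta> \<delta> / 2)\<close>, minimal at \<open>\<theta> = \<delta> / 4\<close>\<close>
  define \<theta> where "\<theta> = \<delta> / 4"
  define w where "w x = \<theta> * ((if x \<in> C then 1 else 0) - \<delta>)" for x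
  define M where "M = Pi_pmf Q False (\<lambda>_. bernoulli_pmf p)"
  define g where "g f = (\<Prod>x\<in>Q. if f x then exp (w x) else 1)" for f
  have g: "g f = exp (\<theta> * (real (card ({x\<in>Q. f x} \<inter> C)) - \<delta> * real (card {x\<in>Q. f x})))" for f
  proof -
    have "g f = (\<Prod>x\<in>{x\<in>Q. f x}. exp (w x))"
      unfolding g_def using Q by (intro prod.mono_neutral_cong_right) auto
    also have "\<dots> = exp (\<Sum>x\<in>{x\<in>Q. f x}. w x)" using Q by (simp add: exp_sum)
    also have "(\<Sum>x\<in>{x\<in>Q. f x}. w x) =
        \<theta> * ((\<Sum>x\<in>{x\<in>Q. f x}. if x \<in> C then 1 else 0) - \<delta> * real (card {x\<in>Q. f x}))"
      unfolding w_def by (simp add: sum_subtractf flip: sum_distrib_left)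
    also have "(\<Sum>x\<in>{x\<in>Q. f x}. if x \<in> C then 1 else 0) = real (card ({x\<in>Q. f x} \<inter> C))"
      using Q by (simp add: sum.If_cases)
    finally show ?thesis .
  qed
  have "finite (set_pmf M)" unfolding M_def using Q(1)
    by (intro finite_subset[OF set_Pi_pmf_subset'] finite_PiE_dflt) auto
  then have int: "integrable (measure_pmf M) h" for h :: "('a \<Rightarrow> bool) \<Rightarrow> real"
    by (rule integrable_measure_pmf_finite)
  have factor: "measure_pmf.expectation (bernoulli_pmf p) (\<lambda>b. if b then exp (w x) else 1)
      \<le> exp (p * (w x + \<theta>\<^sup>2))" for x
  proof -
    have w: "\<bar>w x\<bar> \<le> \<theta>" "\<theta> \<le> 1" unfolding w_def \<theta>_def using \<delta> by (auto simp: abs_mult mult_le_cancel_left1)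
    then have "exp (w x) \<le> 1 + w x + (w x)\<^sup>2" by (intro exp_le_quadratic) linarith
    also have "(w x)\<^sup>2 \<le> \<theta>\<^sup>2" using w(1) by (metis abs_ge_zero power2_abs power_mono)
    finally have "p * exp (w x) \<le> p * (1 + w x + \<theta>\<^sup>2)" using p by (intro mult_left_mono) auto
    then have "p * exp (w x) + (1 - p) \<le> 1 + p * (w x + \<theta>\<^sup>2)" by (simp add: algebra_simps)
    also have "\<dots> \<le> exp (p * (w x + \<theta>\<^sup>2))" by (rule exp_ge_add_one_self)
    finally show ?thesis using p by (simp add: mult.commute)
  qed
  have "(\<Sum>x\<in>Q. w x) = \<theta> * ((\<Sum>x\<in>Q. if x \<in> C then 1 else 0) - \<delta> * real (card Q))"
    unfolding w_def by (simp add: sum_subtractf flip: sum_distrib_left)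
  also have "(\<Sum>x\<in>Q. if x \<in> C then 1 else 0) = real (card C)"
    using Q by (simp add: sum.If_cases Int_absorb1)
  also have "\<theta> * (real (card C) - \<delta> * real (card Q)) \<le> \<theta> * (\<delta> / 2 * real (card Q) - \<delta> * real (card Q))"
    using C \<delta> unfolding \<theta>_def by (intro mult_left_mono) auto
  also have "\<dots> = - 2 * \<theta>\<^sup>2 * real (card Q)"
    unfolding \<theta>_def by (simp add: power2_eq_square field_simps)
  finally have sw: "(\<Sum>x\<in>Q. w x) \<le> - 2 * \<theta>\<^sup>2 * real (card Q)" .
  have "measure_pmf.prob (binomial_subset Q p) {\<Omega>. \<delta> * real (card \<Omega>) \<le> real (card (\<Omega> \<inter> C))}
      = measure_pmf.prob M {f. \<delta> * real (card {x\<in>Q. f x}) \<le> real (card ({x\<in>Q. f x} \<inter> C))}"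
    unfolding binomial_subset_def M_def[symmetric] measure_map_pmf by (simp add: vimage_def)
  also have "\<dots> = measure_pmf.expectation M (indicator {f. \<delta> * real (card {x\<in>Q. f x}) \<le> real (card ({x\<in>Q. f x} \<inter> C))})"
    by simp
  also have "\<dots> \<le> measure_pmf.expectation M g"
  proof (intro integral_mono int)
    fix f show "indicator {f. \<delta> * real (card {x\<in>Q. f x}) \<le> real (card ({x\<in>Q. f x} \<inter> C))} f \<le> g f"
      unfolding g using \<delta> by (auto simp: indicator_def \<theta>_def)
  qed
  also have "\<dots> = (\<Prod>x\<in>Q. measure_pmf.expectation (bernoulli_pmf p) (\<lambda>b. if b then exp (w x) else 1))"
    unfolding M_def g_def using Q
    by (intro expectation_prod_Pi_pmf integrable_measure_pmf_finite finite) auto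
  also have "\<dots> \<le> (\<Prod>x\<in>Q. exp (p * (w x + \<theta>\<^sup>2)))"
    by (intro prod_mono conjI factor integral_nonneg) auto
  also have "\<dots> = exp (p * ((\<Sum>x\<in>Q. w x) + \<theta>\<^sup>2 * real (card Q)))"
    using Q by (simp add: exp_sum[symmetric] sum.distrib mult.commute flip: sum_distrib_left)
  also have "\<dots> \<le> exp (p * (- 2 * \<theta>\<^sup>2 * real (card Q) + \<theta>\<^sup>2 * real (card Q)))"
    using sw p by (intro exp_mono mult_left_mono add_right_mono) auto
  also have "p * (- 2 * \<theta>\<^sup>2 * real (card Q) + \<theta>\<^sup>2 * real (card Q)) = - (\<delta>\<^sup>2 / 16) * (p * real (card Q))"
    unfolding \<theta>_def by (simp add: power2_eq_square field_simps)
  finally show ?thesis .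
qed

section \<open>Affine images in distance sets of random subsets\<close>

text \<open>
  The left-hand side bounds the number of pairs of a distance set and a container. Its logarithm is
  of order \<open>N\<^sup>2\<close>; this is where the exponent must exceed \<open>2\<close>.
\<close>

lemma eventually_box_count_le_exp_powr:
  fixes c e :: real
  assumes "c > 0" "e > 2"
  shows "\<forall>\<^sub>F N :: nat in sequentially.
    2 ^ (4 * d * N\<^sup>2 + 1) * (real ((2 * N + 1) ^ d) + 1) ^ L \<le> exp (c * real N powr e)"
proof -
  define K where "K = real (4 * d + 1 + 2 * (d + 1) * L)"
  have "filterlim (\<lambda>N :: nat. real N powr (e - 2)) at_top sequentially"
    using assms(2) by real_asymp
  then have "\<forall>\<^sub>F N in sequentially. real N powr (e - 2) \<ge> K / c"
    by (simp add: filterlim_at_top)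
  then show ?thesis using eventually_ge_at_top[of 1]
  proof eventually_elim
    case (elim N)
    have N: "1 \<le> real N" "real N \<le> (real N)\<^sup>2"
      using elim(2) by (simp_all add: power2_eq_square)
    have "2 \<le> exp (1::real)" using exp_ge_add_one_self[of 1] by simp
    then have "2 ^ (4 * d * N\<^sup>2 + 1) \<le> exp (1::real) ^ (4 * d * N\<^sup>2 + 1)" by (intro power_mono) auto
    also have "\<dots> = exp (real (4 * d * N\<^sup>2 + 1))" by (subst exp_of_nat_mult[symmetric]) simp
    finally have one: "2 ^ (4 * d * N\<^sup>2 + 1) \<le> exp (real (4 * d * N\<^sup>2 + 1))" .
    have "1 \<le> real (2 * N + 1) ^ d" by (intro one_le_power) simp
    then have "real ((2 * N + 1) ^ d) + 1 \<le> 2 * real (2 * N + 1) ^ d"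
      unfolding of_nat_power by linarith
    also have "\<dots> \<le> real (2 * N + 1) * real (2 * N + 1) ^ d"
      using elim(2) by (intro mult_right_mono) auto
    also have "\<dots> = real (2 * N + 1) ^ (d + 1)" by simp
    also have "\<dots> \<le> exp (2 * real N) ^ (d + 1)"
      using exp_ge_add_one_self[of "2 * real N"] by (intro power_mono) (auto simp: add.commute)
    also have "\<dots> = exp (real (d + 1) * (2 * real N))" by (rule exp_of_nat_mult[symmetric])
    finally have "(real ((2 * N + 1) ^ d) + 1) ^ L \<le> exp (real (d + 1) * (2 * real N)) ^ L"
      by (intro power_mono) auto
    also have "\<dots> = exp (real L * (real (d + 1) * (2 * real N)))" by (rule exp_of_nat_mult[symmetric])
    finally have two: "(real ((2 * N + 1) ^ d) + 1) ^ L \<le> exp (real L * (real (d + 1) * (2 * real N)))" .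
    have "real (4 * d * N\<^sup>2 + 1) + real L * (real (d + 1) * (2 * real N))
      \<le> (4 * real d * (real N)\<^sup>2 + (real N)\<^sup>2) + real L * (real (d + 1) * (2 * (real N)\<^sup>2))"
      using N by (intro add_mono mult_left_mono) auto
    also have "\<dots> = K * (real N)\<^sup>2" unfolding K_def by (simp add: algebra_simps)
    also have "\<dots> \<le> (c * real N powr (e - 2)) * (real N)\<^sup>2"
      using elim(1) assms(1) by (intro mult_right_mono) (auto simp: field_simps)
    also have "\<dots> = c * real N powr e"
      using N(1) powr_add[of "real N" "e - 2" 2] by (simp add: powr_numeral)
    finally have "exp (real (4 * d * N\<^sup>2 + 1) + real L * (real (d + 1) * (2 * real N))) \<le> exp (c * real N powr e)"
      by simp
    moreover have "2 ^ (4 * d * N\<^sup>2 + 1) * (real ((2 * N + 1) ^ d) + 1) ^ L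
      \<le> exp (real (4 * d * N\<^sup>2 + 1)) * exp (real L * (real (d + 1) * (2 * real N)))"
      using one two by (intro mult_mono) auto
    ultimately show ?case by (simp only: exp_add)
  qed
qed

theorem theorem3:
  fixes \<gamma> \<delta> :: real
  assumes "CARD('d::finite) \<ge> 5"
    and "0 < \<gamma>" and "\<gamma> < real CARD('d) - 2"
    and "0 < \<delta>" and "\<delta> < 1"
  shows "\<exists>c>0. \<forall>F :: int set. finite F \<and> card F \<ge> 2 \<longrightarrow>
    (\<forall>\<^sub>F N in sequentially.
      measure_pmf.prob
        (binomial_subset (lattice_box N :: (int ^ 'd) set) (real N powr (- \<gamma>)))
        {\<Omega>. \<forall>B\<subseteq>\<Omega>. real (card B) \<ge> \<delta> * real (card \<Omega>) \<longrightarrow>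
              (\<exists>(a::int) (t::nat). t \<ge> 1 \<and> (\<lambda>f. a + int t * f) ` F \<subseteq> sq_dist_set B)}
      \<ge> 1 - exp (- c * real N powr (real CARD('d) - \<gamma>)))"
proof -
  let ?d = "CARD('d)"
  \<comment> \<open>half of the Chernoff exponent; the other half pays for the union bound\<close>
  define c where "c = \<delta>\<^sup>2 / 32"
  have c: "c > 0" unfolding c_def using assms(4) by simp
  have "\<forall>\<^sub>F N in sequentially.
      measure_pmf.prob
        (binomial_subset (lattice_box N :: (int ^ 'd) set) (real N powr (- \<gamma>)))
        {\<Omega>. \<forall>B\<subseteq>\<Omega>. real (card B) \<ge> \<delta> * real (card \<Omega>) \<longrightarrow>
              (\<exists>(a::int) (t::nat). t \<ge> 1 \<and> (\<lambda>f. a + int t * f) ` F \<subseteq> sq_dist_set B)}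
      \<ge> 1 - exp (- c * real N powr (real ?d - \<gamma>))" if F: "finite F" for F :: "int set"
  proof -
    define avoids where "avoids D \<longleftrightarrow> (\<forall>a t. t \<ge> (1::nat) \<longrightarrow> \<not> (\<lambda>f. a + int t * f) ` F \<subseteq> D)"
      for D :: "int set"
    have "?d \<ge> 4" "\<delta> / 2 > 0" using assms by auto
    from affine_avoiding_supersaturation[where 'd='d, OF this(1) F this(2), folded avoids_def]
    obtain \<beta> where \<beta>: "\<beta> > 0" and ev: "\<forall>\<^sub>F N in sequentially. \<forall>D A. avoids D \<longrightarrow>
      A \<subseteq> (lattice_box N :: (int ^ 'd) set) \<longrightarrow>
      real (card A) \<ge> \<delta> / 2 * real (card (lattice_box N :: (int ^ 'd) set)) \<longrightarrow>
      real (card {(x, y) \<in> A \<times> A. sq_dist x y \<notin> D}) \<ge> \<beta> * (real (card (lattice_box N :: (int ^ 'd) set)))\<^sup>2"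
      by blast
    obtain L :: nat where L: "real L > 2 / \<beta>" using reals_Archimedean2 by blast
    have e: "real ?d - \<gamma> > 2" using assms(3) by simp
    from ev eventually_box_count_le_exp_powr[OF c e, of ?d L] eventually_ge_at_top[of 1]
    show ?thesis
    proof eventually_elim
      case (elim N)
      define Q where "Q = (lattice_box N :: (int ^ 'd) set)"
      define n where "n = card Q"
      define p where "p = real N powr (- \<gamma>)"
      define M where "M = binomial_subset Q p"
      define tail where "tail X = {\<Omega> :: (int ^ 'd) set. \<delta> * real (card \<Omega>) \<le> real (card (\<Omega> \<inter> X))}" for X
      define good where "good = {\<Omega> :: (int ^ 'd) set. \<forall>B\<subseteq>\<Omega>. real (card B) \<ge> \<delta> * real (card \<Omega>) \<longrightarrow>
              (\<exists>(a::int) (t::nat). t \<ge> 1 \<and> (\<lambda>f. a + int t * f) ` F \<subseteq> sq_dist_set B)}"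
      define \<D> where "\<D> = {D. D \<subseteq> {0..int (4 * ?d * N\<^sup>2)} \<and> avoids D}"
      have Q: "finite Q" "n = (2 * N + 1) ^ ?d"
        unfolding Q_def n_def by (rule finite_lattice_box card_lattice_box)+
      have n0: "n > 0" unfolding Q(2) by simp
      have p: "0 \<le> p" "p \<le> 1"
        unfolding p_def using powr_mono[of "- \<gamma>" 0 "real N"] elim(3) assms(2) by simp_all
      have fin\<D>: "finite \<D>" unfolding \<D>_def by (rule finite_subset[of _ "Pow {0..int (4 * ?d * N\<^sup>2)}"]) auto
      have card_Pow_interval: "card (Pow {0..int K}) = 2 ^ (K + 1)" for K
        by (simp add: card_Pow nat_add_distrib)
      have "card \<D> \<le> card (Pow {0..int (4 * ?d * N\<^sup>2)})" unfolding \<D>_def by (intro card_mono) auto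
      also have "\<dots> = 2 ^ (4 * ?d * N\<^sup>2 + 1)" by (rule card_Pow_interval)
      finally have card\<D>: "real (card \<D>) \<le> 2 ^ (4 * ?d * N\<^sup>2 + 1)"
        by (metis of_nat_le_iff of_nat_numeral of_nat_power)
      have "\<exists>\<C>. finite \<C> \<and> card \<C> \<le> (n + 1) ^ L \<and> (\<forall>X\<in>\<C>. X \<subseteq> Q \<and> real (card X) \<le> \<delta> / 2 * real n) \<and>
          (\<forall>B\<subseteq>Q. (\<forall>x\<in>B. \<forall>y\<in>B. sq_dist x y \<in> D) \<longrightarrow> (\<exists>X\<in>\<C>. B \<subseteq> X))" if D: "D \<in> \<D>" for D
        unfolding n_def
      proof (rule clique_containers)
        show "finite Q" by (rule Q)
        show "\<beta> / 2 * real n > 0" using \<beta> n0 by simp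
        show "\<delta> / 2 * real (card Q) \<ge> 0" using assms(4) by simp
        show "real (card {(x, y) \<in> A \<times> A. sq_dist x y \<notin> D}) \<ge> 2 * (\<beta> / 2 * real n) * real (card Q)"
          if "A \<subseteq> Q" "real (card A) > \<delta> / 2 * real (card Q)" for A
          using elim(1) D that unfolding \<D>_def Q_def n_def by (force simp: power2_eq_square mult.assoc)
        have "1 \<le> real L * (\<beta> / 2)" using L \<beta> by (simp add: field_simps)
        then have "1 * real n \<le> real L * (\<beta> / 2) * real n" by (intro mult_right_mono) auto
        then show "real (card Q) \<le> \<delta> / 2 * real (card Q) + real L * (\<beta> / 2 * real n)"
          using assms(4) unfolding n_def by (simp add: mult.assoc add_increasing)
      qed simp
      then obtain \<C> where
        \<C>: "\<And>D. D \<in> \<D> \<Longrightarrow> finite (\<C> D)" "\<And>D. D \<in> \<D> \<Longrightarrow> card (\<C> D) \<le> (n + 1) ^ L"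
          "\<And>D X. D \<in> \<D> \<Longrightarrow> X \<in> \<C> D \<Longrightarrow> X \<subseteq> Q \<and> real (card X) \<le> \<delta> / 2 * real n"
          "\<And>D B. D \<in> \<D> \<Longrightarrow> B \<subseteq> Q \<Longrightarrow> \<forall>x\<in>B. \<forall>y\<in>B. sq_dist x y \<in> D \<Longrightarrow> \<exists>X\<in>\<C> D. B \<subseteq> X"
        by metis
      \<comment> \<open>a bad \<open>\<Omega>\<close> has a dense clique for \<open>D = sq_dist_set B\<close>, which sits inside a container\<close>
      have cover: "- good \<inter> set_pmf M \<subseteq> (\<Union>D\<in>\<D>. \<Union>X\<in>\<C> D. tail X)"
      proof
        fix \<Omega> assume \<Omega>: "\<Omega> \<in> - good \<inter> set_pmf M"
        have \<Omega>Q: "\<Omega> \<subseteq> Q" using \<Omega> unfolding M_def binomial_subset_def by auto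
        obtain B where B: "B \<subseteq> \<Omega>" "real (card B) \<ge> \<delta> * real (card \<Omega>)" "avoids (sq_dist_set B)"
          using \<Omega> unfolding good_def avoids_def by blast
        have "sq_dist_set B \<subseteq> {0..int (4 * ?d * N\<^sup>2)}"
          using B(1) \<Omega>Q sq_dist_bounds unfolding sq_dist_set_def Q_def by blast
        then have D: "sq_dist_set B \<in> \<D>" using B(3) unfolding \<D>_def by blast
        have "\<forall>x\<in>B. \<forall>y\<in>B. sq_dist x y \<in> sq_dist_set B" unfolding sq_dist_set_def by blast
        then obtain X where X: "X \<in> \<C> (sq_dist_set B)" "B \<subseteq> X"
          using \<C>(4)[OF D order_trans[OF B(1) \<Omega>Q]] by blast
        have "finite (\<Omega> \<inter> X)" using finite_subset[OF \<Omega>Q Q(1)] by simp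
        then have "card B \<le> card (\<Omega> \<inter> X)" using B(1) X(2) by (intro card_mono) auto
        then have "\<Omega> \<in> tail X" unfolding tail_def using B(2) by simp
        then show "\<Omega> \<in> (\<Union>D\<in>\<D>. \<Union>X\<in>\<C> D. tail X)" using D X(1) by blast
      qed
      have pn: "real N powr (real ?d - \<gamma>) \<le> p * real n"
      proof -
        have "real N powr (real ?d - \<gamma>) = p * real N ^ ?d"
          unfolding p_def using elim(3) by (simp add: powr_diff powr_minus powr_realpow field_simps)
        also have "\<dots> \<le> p * real n" unfolding Q(2) of_nat_power using p by (intro mult_left_mono power_mono) auto
        finally show ?thesis .
      qed
      have one: "measure_pmf.prob M (tail X) \<le> exp (- (2 * c) * real N powr (real ?d - \<gamma>))"
        if "D \<in> \<D>" "X \<in> \<C> D" for D X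
      proof -
        have "measure_pmf.prob M (tail X) \<le> exp (- (\<delta>\<^sup>2 / 16) * (p * real (card Q)))"
          unfolding M_def tail_def using \<C>(3)[OF that] Q(1) p assms(4,5)
          by (intro binomial_subset_relative_upper_tail) (auto simp: n_def)
        also have "\<dots> \<le> exp (- (\<delta>\<^sup>2 / 16) * real N powr (real ?d - \<gamma>))"
          using pn unfolding n_def by (intro exp_mono mult_left_mono_neg) auto
        finally show ?thesis unfolding c_def by simp
      qed
      have "measure_pmf.prob M (- good) = measure_pmf.prob M (- good \<inter> set_pmf M)"
        by (rule measure_Int_set_pmf[symmetric])
      also have "\<dots> \<le> measure_pmf.prob M (\<Union>D\<in>\<D>. \<Union>X\<in>\<C> D. tail X)"
        by (intro measure_pmf.finite_measure_mono cover) auto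
      also have "\<dots> \<le> (\<Sum>D\<in>\<D>. measure_pmf.prob M (\<Union>X\<in>\<C> D. tail X))"
        using fin\<D> by (intro measure_pmf.finite_measure_subadditive_finite) auto
      also have "\<dots> \<le> (\<Sum>D\<in>\<D>. \<Sum>X\<in>\<C> D. measure_pmf.prob M (tail X))"
        using \<C>(1) by (intro sum_mono measure_pmf.finite_measure_subadditive_finite) auto
      also have "\<dots> \<le> (\<Sum>D\<in>\<D>. \<Sum>X\<in>\<C> D. exp (- (2 * c) * real N powr (real ?d - \<gamma>)))"
        by (intro sum_mono one)
      also have "\<dots> = (\<Sum>D\<in>\<D>. real (card (\<C> D))) * exp (- (2 * c) * real N powr (real ?d - \<gamma>))"
        by (simp add: sum_distrib_right)
      also have "\<dots> \<le> (\<Sum>D\<in>\<D>. (real n + 1) ^ L) * exp (- (2 * c) * real N powr (real ?d - \<gamma>))"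
      proof (intro mult_right_mono sum_mono)
        fix D assume "D \<in> \<D>"
        then have "real (card (\<C> D)) \<le> real ((n + 1) ^ L)" using \<C>(2) of_nat_le_iff by blast
        then show "real (card (\<C> D)) \<le> (real n + 1) ^ L" by (simp add: add.commute)
      qed simp
      also have "\<dots> \<le> (2 ^ (4 * ?d * N\<^sup>2 + 1) * (real n + 1) ^ L) * exp (- (2 * c) * real N powr (real ?d - \<gamma>))"
        using card\<D> by (simp add: mult_right_mono)
      also have "\<dots> \<le> exp (c * real N powr (real ?d - \<gamma>)) * exp (- (2 * c) * real N powr (real ?d - \<gamma>))"
        using elim(2) unfolding Q(2) by (intro mult_right_mono) auto
      also have "\<dots> = exp (- c * real N powr (real ?d - \<gamma>))"
        by (simp flip: exp_add)
      finally have "measure_pmf.prob M (- good) \<le> exp (- c * real N powr (real ?d - \<gamma>))" .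
      moreover have "measure_pmf.prob M (- good) = 1 - measure_pmf.prob M good"
        using measure_pmf.prob_compl[of good M] by (simp add: Compl_eq_Diff_UNIV)
      ultimately show ?case unfolding good_def M_def Q_def p_def by linarith
    qed
  qed
  then show ?thesis using c by blast
qed

end
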